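(* Let $P\in\mathbb{H}^{n\times n}$ be a nontrivial generalized reflection matrix, and let $U=[U_1,\ U_2]\in\mathbb{H}^{n\times n}$ be a unitary matrix, with $U_1\in\mathbb{H}^{n\times r_1}$, $U_2\in\mathbb{H}^{n\times(n-r_1)}$, such that $$P=U\begin{bmatrix} I_{r_1}&0\\ 0&-I_{n-r_1}\end{bmatrix}U^*.$$ Let $Z\in\mathbb{H}^{n\times m}$ and $\Lambda=\mathrm{diag}(\lambda_1,\dots,\lambda_m)$, where $\lambda_1,\dots,\lambda_m$ are complex numbers with nonnegative imaginary parts. Let $0<k<m$ and suppose that $$Z=[U_1X_1,\ U_2X_2],\qquad \Lambda=\begin{bmatrix}\Phi&0\\ 0&\Psi\end{bmatrix},$$ where $X_1\in\mathbb{H}^{r_1\times k}$, $X_2\in\mathbb{H}^{(n-r_1)\times(m-k)}$, $\Phi=\mathrm{diag}(\lambda_1,\dots,\lambda_k)$, $\Psi=\mathrm{diag}(\lambda_{k+1},\dots,\lambda_m)$. Then the set $$\varphi_1''(Z,\Lambda)=\{A\in\mathbb{H}_r^{n\times n}(P,P)\ :\ AZ=Z\Lambda\}$$ is nonempty if and only if $$X_1\Phi X_1^{+}X_1=X_1\Phi,\qquad X_2\Psi X_2^{+}X_2=X_2\Psi.$$ In that case, the general expression of $A\in\varphi_1''(Z,\Lambda)$ is $$A=[U_1,\ U_2]\begin{bmatrix}X_1\Phi X_1^{+}+W_1R_{X_1}&0\\ 0&X_2\Psi X_2^{+}+W_2R_{X_2}\end{bmatrix}\begin{bmatrix}U_1^*\\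 U_2^*\end{bmatrix},$$ where $W_1\in\mathbb{H}^{r_1\times r_1}$ and $W_2\in\mathbb{H}^{(n-r_1)\times(n-r_1)}$ are arbitrary.
   Context: $\mathbb{H}$ is the real quaternion algebra, $\mathbb{H}^{m\times n}$ the set of $m\times n$ matrices over $\mathbb{H}$, and $^*$ denotes conjugate transpose. A matrix $P\in\mathbb{H}^{n\times n}$ is a nontrivial generalized reflection matrix if $P^*=P\neq I$ and $P^2=I$. $\mathbb{H}_r^{n\times n}(P,P)=\{A\in\mathbb{H}^{n\times n}: A=PAP\}$ is the set of reflexive matrices with respect to $P$. For a matrix $X$, $X^{+}$ denotes an arbitrary but fixed reflexive inverse of $X$, i.e. a matrix with $XX^{+}X=X$ and $X^{+}XX^{+}=X^{+}$; and $R_X=I-XX^{+}$. "General expression" means that $\varphi_1''(Z,\Lambda)$ is exactly the set of matrices of the displayed form as $W_1,W_2$ vary. *)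

theory Defs
  imports Complex_Main "Jordan_Normal_Form.Matrix"
begin

section \<open>The real quaternion algebra\<close>

text \<open>\<open>Quat a b c d\<close> is $a + b i + c j + d k$.\<close>

datatype quat = Quat (qRe: real) (qI: real) (qJ: real) (qK: real)

lemma quat_eq_iff:
  "x = y \<longleftrightarrow> qRe x = qRe y \<and> qI x = qI y \<and> qJ x = qJ y \<and> qK x = qK y"
  by (cases x; cases y) auto

instantiation quat :: real_div_algebra
begin

definition "0 = Quat 0 0 0 0"
definition "1 = Quat 1 0 0 0"
definition "x + y = Quat (qRe x + qRe y) (qI x + qI y) (qJ x + qJ y) (qK x + qK y)"
definition "- x = Quat (- qRe x) (- qI x) (- qJ x) (- qK x)"
definition "x - y = Quat (qRe x - qRe y) (qI x - qI y) (qJ x - qJ y) (qK x - qK y)"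
definition "r *\<^sub>R x = Quat (r * qRe x) (r * qI x) (r * qJ x) (r * qK x)"

text \<open>The Hamilton product: $i^2 = j^2 = k^2 = ijk = -1$.\<close>
definition "x * y = Quat
  (qRe x * qRe y - qI x * qI y - qJ x * qJ y - qK x * qK y)
  (qRe x * qI y + qI x * qRe y + qJ x * qK y - qK x * qJ y)
  (qRe x * qJ y - qI x * qK y + qJ x * qRe y + qK x * qI y)
  (qRe x * qK y + qI x * qJ y - qJ x * qI y + qK x * qRe y)"

definition "inverse x =
  (let s = (qRe x)\<^sup>2 + (qI x)\<^sup>2 + (qJ x)\<^sup>2 + (qK x)\<^sup>2
   in Quat (qRe x / s) (- qI x / s) (- qJ x / s) (- qK x / s))"
definition "x div y = x * inverse (y :: quat)"

lemmas quat_ops = zero_quat_def one_quat_def plus_quat_def uminus_quat_def minus_quat_def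
  scaleR_quat_def times_quat_def

lemma quat_norm_pos:
  assumes "x \<noteq> (0::quat)"
  shows "(qRe x)\<^sup>2 + (qI x)\<^sup>2 + (qJ x)\<^sup>2 + (qK x)\<^sup>2 > 0"
proof -
  have "qRe x \<noteq> 0 \<or> qI x \<noteq> 0 \<or> qJ x \<noteq> 0 \<or> qK x \<noteq> 0"
    using assms by (auto simp: quat_eq_iff quat_ops)
  then show ?thesis
    using zero_le_power2[of "qRe x"] zero_le_power2[of "qI x"] zero_le_power2[of "qJ x"]
      zero_le_power2[of "qK x"] zero_less_power2 by (smt (verit))
qed

instance
proof
  fix x :: quat
  assume x: "x \<noteq> 0"
  define s where "s = (qRe x)\<^sup>2 + (qI x)\<^sup>2 + (qJ x)\<^sup>2 + (qK x)\<^sup>2"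
  have s0: "s \<noteq> 0" using quat_norm_pos[OF x] by (simp add: s_def)
  have inv: "inverse x = Quat (qRe x / s) (- qI x / s) (- qJ x / s) (- qK x / s)"
    by (simp add: inverse_quat_def s_def Let_def)
  have one: "qRe x * qRe x / s + qI x * qI x / s + qJ x * qJ x / s + qK x * qK x / s = 1"
    using s0 by (simp add: add_divide_distrib[symmetric] s_def power2_eq_square)
  show "inverse x * x = 1" "x * inverse x = 1"
    using one by (simp_all add: inv quat_ops mult.commute)
next
  show "inverse (0::quat) = 0"
    by (simp add: inverse_quat_def quat_ops)
qed (auto simp: quat_eq_iff quat_ops divide_quat_def algebra_simps)

end

instantiation quat :: conjugate
begin

definition "conjugate x = Quat (qRe x) (- qI x) (- qJ x) (- qK x)"

instance
  by standard (auto simp: quat_eq_iff conjugate_quat_def)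

end

definition quat_of_complex :: "complex \<Rightarrow> quat" where
  "quat_of_complex z = Quat (Re z) (Im z) 0 0"


section \<open>Quaternion matrices\<close>

text \<open>The library's \<open>mat_adjoint\<close> requires a (commutative) field of entries.\<close>

definition conj_transpose :: "quat mat \<Rightarrow> quat mat"  (\<open>(_\<^sup>H)\<close> [1000] 999) where
  "A\<^sup>H = map_mat conjugate (transpose_mat A)"

text \<open>The block row \<open>[A, B]\<close>; the block column of \<open>A\<close> over \<open>B\<close> is the library's
  \<open>A @\<^sub>r B\<close>.\<close>

definition block_row :: "'a :: zero mat \<Rightarrow> 'a mat \<Rightarrow> 'a mat"  (infixr \<open>@\<^sub>c\<close> 65) where
  "A @\<^sub>c B = four_block_mat A B (0\<^sub>m 0 (dim_col A)) (0\<^sub>m 0 (dim_col B))"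

definition unitary_quat_mat :: "nat \<Rightarrow> quat mat \<Rightarrow> bool" where
  "unitary_quat_mat n U \<longleftrightarrow> U \<in> carrier_mat n n \<and> U * U\<^sup>H = 1\<^sub>m n \<and> U\<^sup>H * U = 1\<^sub>m n"

definition nontrivial_generalized_reflection :: "nat \<Rightarrow> quat mat \<Rightarrow> bool" where
  "nontrivial_generalized_reflection n P \<longleftrightarrow>
     P \<in> carrier_mat n n \<and> P\<^sup>H = P \<and> P \<noteq> 1\<^sub>m n \<and> P * P = 1\<^sub>m n"

definition reflexive_matrices :: "nat \<Rightarrow> quat mat \<Rightarrow> quat mat set" where
  "reflexive_matrices n P = {A \<in> carrier_mat n n. A = P * A * P}"

definition is_reflexive_inverse :: "quat mat \<Rightarrow> quat mat \<Rightarrow> bool" where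
  "is_reflexive_inverse X Y \<longleftrightarrow>
     Y \<in> carrier_mat (dim_col X) (dim_row X) \<and> X * Y * X = X \<and> Y * X * Y = Y"

text \<open>\<open>R_compl X Y\<close> is $R_X = I - X X^{+}$ for the chosen reflexive inverse $X^{+} = Y$.\<close>

definition R_compl :: "quat mat \<Rightarrow> quat mat \<Rightarrow> quat mat" where
  "R_compl X Y = 1\<^sub>m (dim_row X) - X * Y"

text \<open>The scalars act from the right, \<open>A * Z = Z * Lam\<close>: the eigenvalues are right eigenvalues.\<close>

definition phi1'' :: "nat \<Rightarrow> quat mat \<Rightarrow> quat mat \<Rightarrow> quat mat \<Rightarrow> quat mat set" where
  "phi1'' n P Z Lam = {A \<in> reflexive_matrices n P. A * Z = Z * Lam}"

end

theory Submission
  imports Defs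
begin

text \<open>
  Conjugation by \<open>U\<close> turns \<open>P\<close> into \<open>diag(I, -I)\<close>, so \<open>A = P * A * P\<close> says exactly that
  \<open>U\<^sup>H * A * U\<close> is block diagonal, say \<open>diag(B1, B2)\<close>. Since \<open>Z = U * diag(X1, X2)\<close>, the equation
  \<open>A * Z = Z * Lam\<close> then decouples into \<open>B1 * X1 = X1 * Phi\<close> and \<open>B2 * X2 = X2 * Psi\<close>, and each
  equation \<open>B * X = C\<close> is solved by means of the inner inverse of \<open>X\<close>.
\<close>

section \<open>Block matrices\<close>

lemma four_block_mat_eq_iff:
  assumes "A \<in> carrier_mat r k" "B \<in> carrier_mat r l" "C \<in> carrier_mat s k" "D \<in> carrier_mat s l"
    and "A' \<in> carrier_mat r k" "B' \<in> carrier_mat r l" "C' \<in> carrier_mat s k" "D' \<in> carrier_mat s l"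
  shows "four_block_mat A B C D = four_block_mat A' B' C' D' \<longleftrightarrow> A = A' \<and> B = B' \<and> C = C' \<and> D = D'"
    (is "?M = ?M' \<longleftrightarrow> _")
proof
  assume eq: "?M = ?M'"
  \<comment> \<open>The common block sizes make the offsets \<open>r\<close> and \<open>k\<close>
    the same on both sides, so each block is read off from the entries at shifted positions.\<close>
  have ix: "?M $$ (i, j) = ?M' $$ (i, j)" for i j
    by (simp add: eq)
  have "A = A'"
  proof (rule eq_matI)
    fix i j assume "i < dim_row A'" "j < dim_col A'"
    then show "A $$ (i, j) = A' $$ (i, j)"
      using ix[of i j] assms by auto
  qed (use assms in auto)
  moreover have "B = B'"
  proof (rule eq_matI)
    fix i j assume "i < dim_row B'" "j < dim_col B'"
    then show "B $$ (i, j) = B' $$ (i, j)"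
      using ix[of i "k + j"] assms by auto
  qed (use assms in auto)
  moreover have "C = C'"
  proof (rule eq_matI)
    fix i j assume "i < dim_row C'" "j < dim_col C'"
    then show "C $$ (i, j) = C' $$ (i, j)"
      using ix[of "r + i" j] assms by auto
  qed (use assms in auto)
  moreover have "D = D'"
  proof (rule eq_matI)
    fix i j assume "i < dim_row D'" "j < dim_col D'"
    then show "D $$ (i, j) = D' $$ (i, j)"
      using ix[of "r + i" "k + j"] assms by auto
  qed (use assms in auto)
  ultimately show "A = A' \<and> B = B' \<and> C = C' \<and> D = D'" by blast
qed auto

text \<open>The zero blocks kill the mixed products; this is what decouples the eigenvalue equation
  into one equation per diagonal block.\<close>

lemma mult_block_diag:
  fixes A B C D :: "'a :: semiring_1 mat"
  assumes "A \<in> carrier_mat r p" "B \<in> carrier_mat s q" "C \<in> carrier_mat p k" "D \<in> carrier_mat q l"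
  shows "four_block_mat A (0\<^sub>m r q) (0\<^sub>m s p) B * four_block_mat C (0\<^sub>m p l) (0\<^sub>m q k) D =
    four_block_mat (A * C) (0\<^sub>m r l) (0\<^sub>m s k) (B * D)"
  by (subst mult_four_block_mat[of _ r p _ q _ s _ _ k _ l]) (use assms in auto)

lemma block_row_mult_block_diag:
  fixes A B C D :: "'a :: semiring_1 mat"
  assumes "A \<in> carrier_mat n p" "B \<in> carrier_mat n q" "C \<in> carrier_mat p k" "D \<in> carrier_mat q l"
  shows "(A @\<^sub>c B) * four_block_mat C (0\<^sub>m p l) (0\<^sub>m q k) D = (A * C) @\<^sub>c (B * D)"
  unfolding block_row_def
  \<comment> \<open>A block row is a two-by-two block matrix whose lower blocks have no rows, hence
    the size \<open>0\<close>.\<close>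
  by (subst mult_four_block_mat[of _ n p _ q _ 0 _ _ k _ l]) (use assms in auto)

text \<open>Turns the right factor \<open>U\<^sup>H\<close> into the block column that appears in
  the general expression.\<close>

lemma conj_transpose_block_row:
  assumes "A \<in> carrier_mat n p" "B \<in> carrier_mat n q"
  shows "(A @\<^sub>c B)\<^sup>H = A\<^sup>H @\<^sub>r B\<^sup>H"
  by (rule eq_matI) (use assms in \<open>auto simp: conj_transpose_def block_row_def append_rows_def\<close>)

section \<open>Matrices fixed under conjugation by a signature matrix\<close>

lemma eq_uminus_mat_iff:
  fixes A :: "'a :: real_vector mat"
  assumes "A \<in> carrier_mat r s"
  shows "A = - A \<longleftrightarrow> A = 0\<^sub>m r s"
proof
  assume eq: "A = - A"
  have "A $$ (i, j) = 0" if "i < r" "j < s" for i j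
  proof -
    have "A $$ (i, j) = - A $$ (i, j)"
      using arg_cong[OF eq, of "\<lambda>M. M $$ (i, j)"] that assms by simp
    \<comment> \<open>A real vector space has no 2-torsion, so being equal to one's own negative
      forces zero.\<close>
    then have "2 *\<^sub>R A $$ (i, j) = 0"
      by (simp add: scaleR_2 eq_neg_iff_add_eq_0)
    then show ?thesis by simp
  qed
  then show "A = 0\<^sub>m r s"
    using assms by (intro eq_matI) auto
next
  assume "A = 0\<^sub>m r s"
  then show "A = - A" by (auto intro!: eq_matI)
qed

text \<open>Left multiplication by \<open>S\<close> negates the lower block row and right
  multiplication the right block column. The diagonal blocks thus survive and the off-diagonal ones
  change sign, so a fixed matrix has \<open>B = - B\<close> and \<open>C = - C\<close>.\<close>

lemma commute_signature_iff:
  fixes A B C D :: "'a :: {real_vector, ring_1} mat"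
  assumes c: "A \<in> carrier_mat r r" "B \<in> carrier_mat r s" "C \<in> carrier_mat s r" "D \<in> carrier_mat s s"
  defines "S \<equiv> four_block_mat (1\<^sub>m r) (0\<^sub>m r s) (0\<^sub>m s r) (- 1\<^sub>m s)"
  shows "four_block_mat A B C D = S * four_block_mat A B C D * S \<longleftrightarrow> B = 0\<^sub>m r s \<and> C = 0\<^sub>m s r"
proof -
  have "S * four_block_mat A B C D = four_block_mat A B (- C) (- D)"
    unfolding S_def by (subst mult_four_block_mat[of _ r r _ s _ s _ _ r _ s]) (use c in auto)
  also have "\<dots> * S = four_block_mat A (- B) (- C) D"
    unfolding S_def by (subst mult_four_block_mat[of _ r r _ s _ s _ _ r _ s]) (use c in auto)
  finally have "S * four_block_mat A B C D * S = four_block_mat A (- B) (- C) D" .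
  then show ?thesis
    using c by (simp add: four_block_mat_eq_iff[of _ r r _ s _ s] eq_uminus_mat_iff)
qed

section \<open>The matrix equation \<open>B * X = C\<close>\<close>

lemma is_reflexive_inverse_right_solvable_iff:
  assumes X: "X \<in> carrier_mat p q" and C: "C \<in> carrier_mat t q" and Y: "is_reflexive_inverse X Y"
  shows "(\<exists>B \<in> carrier_mat t p. B * X = C) \<longleftrightarrow> C * Y * X = C"
proof
  have Yc: "Y \<in> carrier_mat q p" and XYX: "X * Y * X = X"
    using X Y by (auto simp: is_reflexive_inverse_def)
  assume "\<exists>B \<in> carrier_mat t p. B * X = C"
  then obtain B where B: "B \<in> carrier_mat t p" "B * X = C" by blast
  \<comment> \<open>Substituting \<open>C = B * X\<close> exposes the factor
    \<open>X * Y * X\<close>, which collapses to \<open>X\<close>.\<close>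
  have "C * Y * X = B * (X * Y * X)"
    unfolding B(2)[symmetric] using B(1) X Yc
    by (simp add: assoc_mult_mat[of _ t p _ p _ q] assoc_mult_mat[of _ t p _ q _ p])
  then show "C * Y * X = C" using B XYX by simp
next
  assume "C * Y * X = C"
  \<comment> \<open>The condition itself says that \<open>C * Y\<close> is a solution.\<close>
  moreover have "C * Y \<in> carrier_mat t p"
    using X C Y by (auto simp: is_reflexive_inverse_def)
  ultimately show "\<exists>B \<in> carrier_mat t p. B * X = C" by blast
qed

text \<open>\<open>C * Y\<close> is a particular solution, and \<open>R_compl X Y\<close>
  annihilates \<open>X\<close> from the left, so its left multiples solve the homogeneous equation.
  Every solution \<open>B\<close> is reached with the parameter \<open>W = B\<close>, because
  \<open>B * R_compl X Y = B - B * X * Y = B - C * Y\<close>.\<close>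

lemma is_reflexive_inverse_right_solutions:
  assumes X: "X \<in> carrier_mat p q" and C: "C \<in> carrier_mat t q" and Y: "is_reflexive_inverse X Y"
    and CYX: "C * Y * X = C"
  shows "{B \<in> carrier_mat t p. B * X = C} = {C * Y + W * R_compl X Y | W. W \<in> carrier_mat t p}"
proof -
  have Yc: "Y \<in> carrier_mat q p" and XYX: "X * Y * X = X"
    using X Y by (auto simp: is_reflexive_inverse_def)
  have R: "R_compl X Y \<in> carrier_mat p p"
    using X Yc by (auto simp: R_compl_def)
  have "R_compl X Y * X = X - X * Y * X"
    unfolding R_compl_def by (subst minus_mult_distrib_mat[of _ p p]) (use X Yc in auto)
  then have RX: "R_compl X Y * X = 0\<^sub>m p q"
    using X XYX by simp
  have "C * Y + W * R_compl X Y \<in> carrier_mat t p"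
    "(C * Y + W * R_compl X Y) * X = C" if W: "W \<in> carrier_mat t p" for W
  proof -
    show "C * Y + W * R_compl X Y \<in> carrier_mat t p"
      using C Yc W R by auto
    have "(C * Y + W * R_compl X Y) * X = C * Y * X + W * (R_compl X Y * X)"
      by (subst add_mult_distrib_mat[of _ t p])
        (use C Yc W R X in \<open>auto simp: assoc_mult_mat[of _ t p _ p _ q]\<close>)
    then show "(C * Y + W * R_compl X Y) * X = C"
      using CYX RX W C by simp
  qed
  moreover have "B = C * Y + B * R_compl X Y" if B: "B \<in> carrier_mat t p" "B * X = C" for B
  proof -
    have "B * R_compl X Y = B - B * (X * Y)"
      unfolding R_compl_def by (subst mult_minus_distrib_mat[of _ t p _ p]) (use X Yc B in auto)
    also have "B * (X * Y) = C * Y"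
      using B X Yc by (metis assoc_mult_mat)
    finally show ?thesis
      using C Yc B by (auto intro!: eq_matI)
  qed
  ultimately show ?thesis by blast
qed

section \<open>Cancellation of unitary factors\<close>

lemma unitary_quat_mat_conj_transpose_carrier:
  "unitary_quat_mat n U \<Longrightarrow> U\<^sup>H \<in> carrier_mat n n"
  by (auto simp: unitary_quat_mat_def conj_transpose_def)

text \<open>The right-nested form lets these equations act as rewrite rules once associativity has
  moved all brackets to the right. The width \<open>m\<close> is free, to cover both square matrices
  and the factor of \<open>Z\<close>.\<close>

lemma unitary_quat_mat_cancel:
  assumes U: "unitary_quat_mat n U" and A: "A \<in> carrier_mat n m"
  shows "U\<^sup>H * (U * A) = A" "U * (U\<^sup>H * A) = A"
proof -
  have c: "U \<in> carrier_mat n n" "U\<^sup>H \<in> carrier_mat n n"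
    using U unitary_quat_mat_conj_transpose_carrier[OF U] by (auto simp: unitary_quat_mat_def)
  have "U\<^sup>H * (U * A) = U\<^sup>H * U * A" "U * (U\<^sup>H * A) = U * U\<^sup>H * A"
    by (rule assoc_mult_mat[symmetric], fact c A, fact c A, fact A)+
  then show "U\<^sup>H * (U * A) = A" "U * (U\<^sup>H * A) = A"
    using U A by (simp_all add: unitary_quat_mat_def)
qed

lemma unitary_quat_mat_left_cancel_iff:
  assumes "unitary_quat_mat n U" "A \<in> carrier_mat n m" "B \<in> carrier_mat n m"
  shows "U * A = U * B \<longleftrightarrow> A = B"
  using assms unitary_quat_mat_cancel(1) by metis

text \<open>Multiplying by \<open>U\<^sup>H\<close> on the left and \<open>U\<close> on the right
  undoes the similarity.\<close>

lemma unitary_similarity_inj: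
  assumes U: "unitary_quat_mat n U" and A: "A \<in> carrier_mat n n" and B: "B \<in> carrier_mat n n"
  shows "U * A * U\<^sup>H = U * B * U\<^sup>H \<longleftrightarrow> A = B"
proof
  have c: "U \<in> carrier_mat n n" "U\<^sup>H \<in> carrier_mat n n" and UU: "U\<^sup>H * U = 1\<^sub>m n"
    using U unitary_quat_mat_conj_transpose_carrier[OF U] by (auto simp: unitary_quat_mat_def)
  have inv: "U\<^sup>H * (U * M * U\<^sup>H) * U = M" if "M \<in> carrier_mat n n" for M
    by (simp only: that c UU assoc_mult_mat[of _ n n _ n _ n] mult_carrier_mat[of _ n n _ n]
        unitary_quat_mat_cancel[OF U, of _ n] right_mult_one_mat[of _ n n])
  assume "U * A * U\<^sup>H = U * B * U\<^sup>H"
  then show "A = B"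
    using inv[OF A] inv[OF B] by metis
qed (simp only:)

theorem corollary2p7:
  fixes n m k r1 :: nat
    and P U U1 U2 Z Lam Phi Psi X1 X2 X1p X2p :: "quat mat"
    and lam :: "nat \<Rightarrow> complex"
  assumes P: "nontrivial_generalized_reflection n P"
    and r1: "r1 \<le> n"
    and U: "unitary_quat_mat n U"
    and U1: "U1 \<in> carrier_mat n r1"
    and U2: "U2 \<in> carrier_mat n (n - r1)"
    and U_blocks: "U = U1 @\<^sub>c U2"
    and P_eq: "P = U * four_block_mat (1\<^sub>m r1) (0\<^sub>m r1 (n - r1))
                         (0\<^sub>m (n - r1) r1) (- 1\<^sub>m (n - r1)) * U\<^sup>H"
    and Z: "Z \<in> carrier_mat n m"
    and lam: "\<And>i. i < m \<Longrightarrow> Im (lam i) \<ge> 0"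
    and Lam: "Lam = mat_diag m (\<lambda>i. quat_of_complex (lam i))"
    and k: "0 < k" "k < m"
    and X1: "X1 \<in> carrier_mat r1 k"
    and X2: "X2 \<in> carrier_mat (n - r1) (m - k)"
    and Phi: "Phi = mat_diag k (\<lambda>i. quat_of_complex (lam i))"
    and Psi: "Psi = mat_diag (m - k) (\<lambda>i. quat_of_complex (lam (k + i)))"
    and Z_blocks: "Z = (U1 * X1) @\<^sub>c (U2 * X2)"
    and Lam_blocks: "Lam = four_block_mat Phi (0\<^sub>m k (m - k)) (0\<^sub>m (m - k) k) Psi"
    and X1p: "is_reflexive_inverse X1 X1p"
    and X2p: "is_reflexive_inverse X2 X2p"
  shows "(phi1'' n P Z Lam \<noteq> {} \<longleftrightarrow>
            X1 * Phi * X1p * X1 = X1 * Phi \<and> X2 * Psi * X2p * X2 = X2 * Psi) \<and>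
         (phi1'' n P Z Lam \<noteq> {} \<longrightarrow>
            phi1'' n P Z Lam =
              {(U1 @\<^sub>c U2) *
                 four_block_mat
                   (X1 * Phi * X1p + W1 * R_compl X1 X1p) (0\<^sub>m r1 (n - r1))
                   (0\<^sub>m (n - r1) r1) (X2 * Psi * X2p + W2 * R_compl X2 X2p) *
                 (U1\<^sup>H @\<^sub>r U2\<^sup>H)
               | W1 W2. W1 \<in> carrier_mat r1 r1 \<and> W2 \<in> carrier_mat (n - r1) (n - r1)})"
proof -

  \<comment> \<open>The data in block form\<close>
  define r2 where "r2 = n - r1"
  define l where "l = m - k"
  define S :: "quat mat" where "S = four_block_mat (1\<^sub>m r1) (0\<^sub>m r1 r2) (0\<^sub>m r2 r1) (- 1\<^sub>m r2)"
  define D :: "quat mat \<Rightarrow> quat mat \<Rightarrow> quat mat"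
    where "D = (\<lambda>B1 B2. four_block_mat B1 (0\<^sub>m r1 r2) (0\<^sub>m r2 r1) B2)"
  define Y where "Y = four_block_mat X1 (0\<^sub>m r1 l) (0\<^sub>m r2 k) X2"
  define sol where "sol = (\<lambda>r X C. {B \<in> carrier_mat r r. B * X = (C :: quat mat)})"
  have n: "n = r1 + r2" and m: "m = k + l"
    using r1 k by (auto simp: r2_def l_def)
  \<comment> \<open>Named block sizes replace the truncated differences, so that \<open>n\<close>
    and \<open>m\<close> are literally sums, as the block matrix rules expect.\<close>
  note U2 = U2[folded r2_def] and X2 = X2[folded r2_def l_def]
  have Phic: "Phi \<in> carrier_mat k k" and Psic: "Psi \<in> carrier_mat l l"
    unfolding Phi Psi l_def by auto
  have Uc: "U \<in> carrier_mat n n" "U\<^sup>H \<in> carrier_mat n n" and UU: "U * U\<^sup>H = 1\<^sub>m n"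
    using U unitary_quat_mat_conj_transpose_carrier[OF U] by (auto simp: unitary_quat_mat_def)
  have Sc: "S \<in> carrier_mat n n"
    unfolding S_def n by (rule four_block_carrier_mat) auto
  have Dc: "D B1 B2 \<in> carrier_mat n n" if "B1 \<in> carrier_mat r1 r1" "B2 \<in> carrier_mat r2 r2" for B1 B2
    unfolding D_def n by (rule four_block_carrier_mat) (use that in auto)
  have Yc: "Y \<in> carrier_mat n m"
    unfolding Y_def n m by (rule four_block_carrier_mat) (use X1 X2 in auto)
  have Lamc: "Lam \<in> carrier_mat m m"
    unfolding Lam by auto
  have P': "P = U * S * U\<^sup>H"
    using P_eq by (simp add: S_def r2_def)
  have Z': "Z = U * Y"
    unfolding Z_blocks U_blocks Y_def by (rule block_row_mult_block_diag[symmetric]) fact+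
  have YLam: "Y * Lam = four_block_mat (X1 * Phi) (0\<^sub>m r1 l) (0\<^sub>m r2 k) (X2 * Psi)"
    unfolding Y_def Lam_blocks l_def[symmetric] by (rule mult_block_diag) fact+

  \<comment> \<open>Transfer of both conditions from \<open>A = U * B * U\<^sup>H\<close> to
    \<open>B\<close>\<close>
  have reflexive: "U * B * U\<^sup>H \<in> reflexive_matrices n P \<longleftrightarrow> B = S * B * S"
    if B: "B \<in> carrier_mat n n" for B
  proof -
    \<comment> \<open>Each inner pair \<open>U\<^sup>H * U\<close> cancels; injectivity of the
      similarity then removes the outer factors.\<close>
    have "P * (U * B * U\<^sup>H) * P = U * (S * B * S) * U\<^sup>H"
      unfolding P'
      by (simp only: B Uc Sc assoc_mult_mat[of _ n n _ n _ n] mult_carrier_mat[of _ n n _ n]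
          unitary_quat_mat_cancel[OF U, of _ n])
    moreover have "U * B * U\<^sup>H \<in> carrier_mat n n" "S * B * S \<in> carrier_mat n n"
      using B Uc Sc by auto
    ultimately show ?thesis
      using unitary_similarity_inj[OF U B] by (simp add: reflexive_matrices_def)
  qed
  have eigen: "U * B * U\<^sup>H * Z = Z * Lam \<longleftrightarrow> B * Y = Y * Lam" if B: "B \<in> carrier_mat n n" for B
  proof -
    have "U * B * U\<^sup>H * Z = U * (B * Y)"
      unfolding Z'
      by (simp only: B Uc Yc assoc_mult_mat[of _ n n _ n _ n] assoc_mult_mat[of _ n n _ n _ m]
          mult_carrier_mat[of _ n n _ n] mult_carrier_mat[of _ n n _ m]
          unitary_quat_mat_cancel[OF U, of _ m])
    moreover have "Z * Lam = U * (Y * Lam)"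
      unfolding Z' by (rule assoc_mult_mat) fact+
    ultimately show ?thesis
      using unitary_quat_mat_left_cancel_iff[OF U, of "B * Y" m "Y * Lam"] B Yc Lamc by simp
  qed
  have block_eigen: "D B1 B2 * Y = Y * Lam \<longleftrightarrow> B1 * X1 = X1 * Phi \<and> B2 * X2 = X2 * Psi"
    if B: "B1 \<in> carrier_mat r1 r1" "B2 \<in> carrier_mat r2 r2" for B1 B2
  proof -
    have "D B1 B2 * Y = four_block_mat (B1 * X1) (0\<^sub>m r1 l) (0\<^sub>m r2 k) (B2 * X2)"
      unfolding D_def Y_def by (rule mult_block_diag) fact+
    then show ?thesis
      unfolding YLam using B X1 X2 Phic Psic
      by (simp add: four_block_mat_eq_iff[of _ r1 k _ l _ r2])
  qed
  have block_reflexive: "D B1 B2 = S * D B1 B2 * S"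
    if "B1 \<in> carrier_mat r1 r1" "B2 \<in> carrier_mat r2 r2" for B1 B2
    using commute_signature_iff[of B1 r1 "0\<^sub>m r1 r2" r2 "0\<^sub>m r2 r1" B2] that
    by (simp add: D_def S_def)

  \<comment> \<open>Parametrization by pairs of solutions\<close>
  have phi: "phi1'' n P Z Lam =
    {U * D B1 B2 * U\<^sup>H | B1 B2. B1 \<in> sol r1 X1 (X1 * Phi) \<and> B2 \<in> sol r2 X2 (X2 * Psi)}"
    (is "_ = ?R")
  proof
    show "?R \<subseteq> phi1'' n P Z Lam"
    proof clarify
      fix B1 B2 assume "B1 \<in> sol r1 X1 (X1 * Phi)" "B2 \<in> sol r2 X2 (X2 * Psi)"
      then have B: "B1 \<in> carrier_mat r1 r1" "B2 \<in> carrier_mat r2 r2"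
        and "B1 * X1 = X1 * Phi" "B2 * X2 = X2 * Psi"
        by (auto simp: sol_def)
      then have "U * D B1 B2 * U\<^sup>H * Z = Z * Lam"
        unfolding eigen[OF Dc[OF B]] block_eigen[OF B] by blast
      moreover have "U * D B1 B2 * U\<^sup>H \<in> reflexive_matrices n P"
        unfolding reflexive[OF Dc[OF B]] by (rule block_reflexive[OF B])
      ultimately show "U * D B1 B2 * U\<^sup>H \<in> phi1'' n P Z Lam"
        by (simp add: phi1''_def)
    qed
    show "phi1'' n P Z Lam \<subseteq> ?R"
    proof
      fix A assume A: "A \<in> phi1'' n P Z Lam"
      \<comment> \<open>The inverse similarity recovers \<open>A\<close> as
        \<open>U * B * U\<^sup>H\<close>, so the equivalences above apply to \<open>B\<close>:
        reflexivity makes it block diagonal, and the eigenvalue equation constrains its two diagonal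
        blocks.\<close>
      define B where "B = U\<^sup>H * A * U"
      have Ac: "A \<in> carrier_mat n n"
        using A by (auto simp: phi1''_def reflexive_matrices_def)
      have Bc: "B \<in> carrier_mat n n"
        using Ac Uc by (auto simp: B_def)
      have AB: "A = U * B * U\<^sup>H"
        unfolding B_def
        by (simp only: Ac Uc UU assoc_mult_mat[of _ n n _ n _ n] mult_carrier_mat[of _ n n _ n]
            unitary_quat_mat_cancel[OF U, of _ n] right_mult_one_mat[of _ n n])
      obtain B1 B12 B21 B2 where split: "split_block B r1 r1 = (B1, B12, B21, B2)"
        by (metis prod_cases4)
      note blocks = split_block[OF split, of r2 r2]
      have B: "B1 \<in> carrier_mat r1 r1" "B12 \<in> carrier_mat r1 r2" "B21 \<in> carrier_mat r2 r1"
        "B2 \<in> carrier_mat r2 r2" "B = four_block_mat B1 B12 B21 B2"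
        using blocks Bc n by auto
      have "B = S * B * S"
        using A reflexive[OF Bc] by (simp add: AB phi1''_def)
      then have "B12 = 0\<^sub>m r1 r2" "B21 = 0\<^sub>m r2 r1"
        using commute_signature_iff[OF B(1-4)] unfolding B(5) S_def by auto
      then have BD: "B = D B1 B2"
        by (simp add: B(5) D_def)
      have "B * Y = Y * Lam"
        using A eigen[OF Bc] by (simp add: AB phi1''_def)
      then have "B1 \<in> sol r1 X1 (X1 * Phi)" "B2 \<in> sol r2 X2 (X2 * Psi)"
        using block_eigen[OF B(1,4)] B(1,4) by (auto simp: BD sol_def)
      then show "A \<in> ?R"
        using AB BD by blast
    qed
  qed

  \<comment> \<open>Solvability and the general expression\<close>
  have C1: "X1 * Phi \<in> carrier_mat r1 k" and C2: "X2 * Psi \<in> carrier_mat r2 l"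
    using X1 X2 Phic Psic by auto
  have sol1: "sol r1 X1 (X1 * Phi) \<noteq> {} \<longleftrightarrow> X1 * Phi * X1p * X1 = X1 * Phi"
    using is_reflexive_inverse_right_solvable_iff[OF X1 C1 X1p] by (auto simp: sol_def)
  have sol2: "sol r2 X2 (X2 * Psi) \<noteq> {} \<longleftrightarrow> X2 * Psi * X2p * X2 = X2 * Psi"
    using is_reflexive_inverse_right_solvable_iff[OF X2 C2 X2p] by (auto simp: sol_def)
  \<comment> \<open>The pair \<open>B1\<close>, \<open>B2\<close> ranges over a product of two sets,
    which is nonempty exactly when both factors are.\<close>
  have solvable: "phi1'' n P Z Lam \<noteq> {} \<longleftrightarrow>
      X1 * Phi * X1p * X1 = X1 * Phi \<and> X2 * Psi * X2p * X2 = X2 * Psi"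
    unfolding phi sol1[symmetric] sol2[symmetric] by blast
  moreover have "phi1'' n P Z Lam =
      {U * D (X1 * Phi * X1p + W1 * R_compl X1 X1p) (X2 * Psi * X2p + W2 * R_compl X2 X2p) * U\<^sup>H
       | W1 W2. W1 \<in> carrier_mat r1 r1 \<and> W2 \<in> carrier_mat r2 r2}"
    if "phi1'' n P Z Lam \<noteq> {}"
  proof -
    \<comment> \<open>The explicit solution sets presuppose consistency of both equations, which
      \<open>solvable\<close> extracts from nonemptiness.\<close>
    have sols: "sol r1 X1 (X1 * Phi) =
        {X1 * Phi * X1p + W * R_compl X1 X1p | W. W \<in> carrier_mat r1 r1}"
      "sol r2 X2 (X2 * Psi) =
        {X2 * Psi * X2p + W * R_compl X2 X2p | W. W \<in> carrier_mat r2 r2}"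
      unfolding sol_def
      using is_reflexive_inverse_right_solutions[OF X1 C1 X1p]
        is_reflexive_inverse_right_solutions[OF X2 C2 X2p] solvable that by auto
    show ?thesis
      unfolding phi sols by blast
  qed
  moreover have "U\<^sup>H = U1\<^sup>H @\<^sub>r U2\<^sup>H"
    unfolding U_blocks by (rule conj_transpose_block_row[OF U1 U2])
  ultimately show ?thesis
    by (simp add: D_def r2_def U_blocks)
qed

end
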